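(* Let $f: \mathbb{Z}^n \to \mathbb{R} \cup \{+\infty\}$ be an integrally convex function and $\Psi: \mathbb{Z}^n \to \mathbb{R} \cup \{-\infty\}$ a separable concave function. Assume that $\operatorname{dom} f \cap \operatorname{dom} \Psi \neq \emptyset$ and that $\inf\{ f(x) - \Psi(x) \mid x \in \mathbb{Z}^n\}$ is attained by some $x^*$. Then $$\inf\{ f(x) - \Psi(x) \mid x \in \mathbb{Z}^n\} = \sup\{ \Psi^\circ(p) - f^\bullet(p) \mid p \in \mathbb{R}^n\},$$ and the supremum is attained by some $p^* \in \mathbb{R}^n$. If, in addition, $f$ and $\Psi$ are integer-valued, then $$\inf\{ f(x) - \Psi(x) \mid x \in \mathbb{Z}^n\} = \sup\{ \Psi^\circ(p) - f^\bullet(p) \mid p \in \mathbb{Z}^n\},$$ and this supremum is attained by some $p^* \in \mathbb{Z}^n$.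
   Context: $\operatorname{dom} f = \{x \mid f(x) < +\infty\}$, $\operatorname{dom}\Psi = \{x \mid \Psi(x) > -\infty\}$. For $x \in \mathbb{R}^n$, $N(x) = \{ z \in \mathbb{Z}^n \mid |x_i - z_i| < 1 \ (i=1,\dots,n)\}$; the local convex extension of $f$ is $\tilde f(x) = \min\{ \sum_{y \in N(x)} \lambda_y f(y) \mid \sum_{y \in N(x)} \lambda_y y = x,\ \sum \lambda_y = 1,\ \lambda_y \ge 0\}$, and $f$ is integrally convex if $\tilde f$ is convex on $\mathbb{R}^n$. $\Psi$ is separable concave if $\Psi(x) = \sum_{i=1}^n \psi_i(x_i)$ with $\psi_i: \mathbb{Z} \to \mathbb{R} \cup \{-\infty\}$ such that $\operatorname{dom}\psi_i$ is an interval of integers and $\psi_i(k-1) + \psi_i(k+1) \le 2\psi_i(k)$ for all $k \in \mathbb{Z}$. Conjugates: $f^\bullet(p) = \sup\{\langle p,x\rangle - f(x) \mid x \in \mathbb{Z}^n\}$ and $\Psi^\circ(p) = \inf\{\langle p,x\rangle - \Psi(x) \mid x \in \mathbb{Z}^n\}$ for $p \in \mathbb{R}^n$. *)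

theory Defs
  imports "HOL-Analysis.Analysis"
begin

text \<open>
  Functions with values in \<open>\<real> \<union> {+\<infinity>}\<close> or \<open>\<real> \<union> {-\<infinity>}\<close> are functions into \<^typ>\<open>ereal\<close> that avoid
  the opposite infinity. Recall that \<open>0 * \<infinity> = 0\<close> in \<^typ>\<open>ereal\<close>, which is the usual convention
  for convex combinations of extended-real values.
\<close>

definition real_vec :: "int ^ 'n \<Rightarrow> real ^ 'n" where
  "real_vec z = (\<chi> i. real_of_int (z $ i))"

definition dom_convex :: "('a \<Rightarrow> ereal) \<Rightarrow> 'a set" where
  "dom_convex f = {x. f x < \<infinity>}"

definition dom_concave :: "('a \<Rightarrow> ereal) \<Rightarrow> 'a set" where
  "dom_concave \<Psi> = {x. \<Psi> x > - \<infinity>}"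

definition integral_nbhd :: "real ^ 'n \<Rightarrow> (int ^ 'n) set" where
  "integral_nbhd x = {z. \<forall>i. \<bar>x $ i - real_of_int (z $ i)\<bar> < 1}"

definition convex_weights :: "real ^ 'n \<Rightarrow> (int ^ 'n \<Rightarrow> real) set" where
  "convex_weights x =
     {w. (\<forall>y \<in> integral_nbhd x. 0 \<le> w y)
        \<and> (\<Sum>y \<in> integral_nbhd x. w y) = 1
        \<and> (\<Sum>y \<in> integral_nbhd x. w y *\<^sub>R real_vec y) = x}"

text \<open>
  The infimum below is a minimum: \<open>integral_nbhd x\<close> is finite, \<open>x\<close> lies in its convex hull, and
  the weights supported on the effective domain of \<open>f\<close> form a compact polytope.
\<close>

definition local_convex_extension :: "(int ^ 'n \<Rightarrow> ereal) \<Rightarrow> real ^ 'n \<Rightarrow> ereal" where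
  "local_convex_extension f x =
     (INF w \<in> convex_weights x. \<Sum>y \<in> integral_nbhd x. ereal (w y) * f y)"

text \<open>
  The library's \<^const>\<open>convex_on\<close> covers only real-valued functions. The following is meant for
  functions that never take the value \<open>-\<infinity>\<close>.
\<close>

definition ereal_convex :: "('a::real_vector \<Rightarrow> ereal) \<Rightarrow> bool" where
  "ereal_convex g \<longleftrightarrow>
     (\<forall>x y t. 0 \<le> t \<and> t \<le> 1 \<longrightarrow>
        g ((1 - t) *\<^sub>R x + t *\<^sub>R y) \<le> ereal (1 - t) * g x + ereal t * g y)"

definition integrally_convex :: "(int ^ 'n \<Rightarrow> ereal) \<Rightarrow> bool" where
  "integrally_convex f \<longleftrightarrow> (\<forall>x. f x \<noteq> - \<infinity>) \<and> ereal_convex (local_convex_extension f)"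

definition int_interval :: "int set \<Rightarrow> bool" where
  "int_interval S \<longleftrightarrow> (\<forall>a \<in> S. \<forall>b \<in> S. {a..b} \<subseteq> S)"

definition discrete_concave :: "(int \<Rightarrow> ereal) \<Rightarrow> bool" where
  "discrete_concave \<psi> \<longleftrightarrow>
     (\<forall>k. \<psi> k \<noteq> \<infinity>) \<and> int_interval (dom_concave \<psi>)
     \<and> (\<forall>k. \<psi> (k - 1) + \<psi> (k + 1) \<le> 2 * \<psi> k)"

definition separable_concave :: "(int ^ 'n \<Rightarrow> ereal) \<Rightarrow> bool" where
  "separable_concave \<Psi> \<longleftrightarrow>
     (\<exists>\<psi> :: 'n \<Rightarrow> int \<Rightarrow> ereal.
        (\<forall>i. discrete_concave (\<psi> i)) \<and> (\<forall>x. \<Psi> x = (\<Sum>i \<in> UNIV. \<psi> i (x $ i))))"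

definition convex_conjugate :: "(int ^ 'n \<Rightarrow> ereal) \<Rightarrow> real ^ 'n \<Rightarrow> ereal" where
  "convex_conjugate f p = (SUP x. ereal (p \<bullet> real_vec x) - f x)"

definition concave_conjugate :: "(int ^ 'n \<Rightarrow> ereal) \<Rightarrow> real ^ 'n \<Rightarrow> ereal" where
  "concave_conjugate \<Psi> p = (INF x. ereal (p \<bullet> real_vec x) - \<Psi> x)"

end

theory Submission
  imports Defs
begin

text \<open>
  Let \<open>c\<close> be a minimiser of \<open>f - \<Psi>\<close>. It suffices to find a common subgradient \<open>p\<close> of \<open>f\<close> and \<open>\<Psi>\<close> at \<open>c\<close>,
  and by integral convexity the subgradient inequality for \<open>f\<close> only has to hold on the cube
  \<open>c + {-1, 0, 1}\<^sup>n\<close>. There, optimality of \<open>c\<close> says \<open>f \<ge> f c + h\<close>, where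
  \<open>h x = (\<Sum>i. min (a\<^sub>i * (x\<^sub>i - c\<^sub>i)) (b\<^sub>i * (x\<^sub>i - c\<^sub>i)))\<close> and \<open>b\<^sub>i \<le> a\<^sub>i\<close> are the right and left
  slopes of \<open>\<psi>\<^sub>i\<close> at \<open>c\<^sub>i\<close>. The slopes are merged to a single number \<open>p\<^sub>k \<in> [b\<^sub>k, a\<^sub>k]\<close> one coordinate at
  a time, as in Fourier-Motzkin elimination: the constraints on \<open>p\<^sub>k\<close> are lower bounds from points \<open>y\<close>
  with \<open>y\<^sub>k = c\<^sub>k - 1\<close> and upper bounds from points \<open>x\<close> with \<open>x\<^sub>k = c\<^sub>k + 1\<close>, and they are compatible
  because \<open>f x + f y\<close> is at least twice the local convex extension of \<open>f\<close> at the midpoint, whose integral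
  neighbours \<open>z\<close> all have \<open>z\<^sub>k = c\<^sub>k\<close> and lie in one orthant where \<open>h\<close> is linear. For integral
  data the bounds are integers, so \<open>p\<^sub>k\<close> can be chosen integral.
\<close>

section \<open>Piecewise linear minorants on the cube around a lattice point\<close>

definition unit_cube :: "int ^ 'n \<Rightarrow> (int ^ 'n) set" where
  "unit_cube c = {z. \<forall>i. \<bar>z $ i - c $ i\<bar> \<le> 1}"

text \<open>For \<open>b \<le> a\<close> this is \<open>min (a * t) (b * t)\<close>. The case form
  shows linearity on each side of 0 without comparing the slopes.\<close>

definition hinge :: "real \<Rightarrow> real \<Rightarrow> real \<Rightarrow> real" where
  "hinge a b t = (if 0 \<le> t then b * t else a * t)"

definition hinge_sum :: "('n \<Rightarrow> real) \<Rightarrow> ('n \<Rightarrow> real) \<Rightarrow> int ^ 'n \<Rightarrow> real ^ 'n \<Rightarrow> real" where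
  "hinge_sum a b c x = (\<Sum>i\<in>UNIV. hinge (a i) (b i) (x $ i - real_of_int (c $ i)))"

text \<open>Testing only the finite cube leaves finitely many constraints on the slopes;
  \<open>r\<close> is the value of the minorant at \<open>c\<close>.\<close>

definition hinge_minorant ::
  "(int ^ 'n \<Rightarrow> ereal) \<Rightarrow> int ^ 'n \<Rightarrow> real \<Rightarrow> ('n \<Rightarrow> real) \<Rightarrow> ('n \<Rightarrow> real) \<Rightarrow> bool" where
  "hinge_minorant f c r a b \<longleftrightarrow>
     (\<forall>z \<in> unit_cube c. ereal (r + hinge_sum a b c (real_vec z)) \<le> f z)"

section \<open>Lattice cubes and integral neighbourhoods\<close>

lemma real_vec_nth [simp]: "real_vec z $ i = real_of_int (z $ i)"
  by (simp add: real_vec_def)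

lemma finite_vec_box:
  fixes S :: "'n::finite \<Rightarrow> 'a set"
  assumes "\<And>i. finite (S i)"
  shows "finite {z :: 'a ^ 'n. \<forall>i. z $ i \<in> S i}"
proof (rule finite_subset)
  show "{z :: 'a ^ 'n. \<forall>i. z $ i \<in> S i} \<subseteq> vec_lambda ` (\<Pi>\<^sub>E i\<in>UNIV. S i)"
  proof
    fix z :: "'a ^ 'n"
    assume "z \<in> {z. \<forall>i. z $ i \<in> S i}"
    then have "(\<lambda>i. z $ i) \<in> (\<Pi>\<^sub>E i\<in>UNIV. S i)" by auto
    then show "z \<in> vec_lambda ` (\<Pi>\<^sub>E i\<in>UNIV. S i)"
      by (metis image_eqI vec_nth_inverse)
  qed
  show "finite (vec_lambda ` (\<Pi>\<^sub>E i\<in>UNIV. S i))"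
    using assms by (intro finite_imageI finite_PiE) auto
qed

lemma finite_unit_cube: "finite (unit_cube c)"
  by (rule finite_subset[OF _ finite_vec_box[of "\<lambda>i. {c $ i - 1..c $ i + 1}"]])
    (auto simp: unit_cube_def abs_le_iff algebra_simps)

text \<open>A neighbour differs from \<open>c\<close> by less than 2 in each coordinate, hence by at
  most 1. So data on the cube control the local convex extension on the whole box.\<close>

lemma integral_nbhd_subset_unit_cube:
  assumes "\<And>i. \<bar>x $ i - real_of_int (c $ i)\<bar> \<le> 1"
  shows "integral_nbhd x \<subseteq> unit_cube c"
proof
  fix z assume z: "z \<in> integral_nbhd x"
  have "\<bar>z $ i - c $ i\<bar> \<le> 1" for i
  proof -
    have "\<bar>x $ i - real_of_int (z $ i)\<bar> < 1" using z by (simp add: integral_nbhd_def)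
    with assms[of i] have "\<bar>real_of_int (z $ i) - real_of_int (c $ i)\<bar> < 2" by linarith
    then show ?thesis by linarith
  qed
  then show "z \<in> unit_cube c" by (simp add: unit_cube_def)
qed

lemma integral_nbhd_real_vec: "integral_nbhd (real_vec z) = {z}"
proof -
  have "y = z" if "y \<in> integral_nbhd (real_vec z)" for y
  proof -
    have "y $ i = z $ i" for i
      using that unfolding integral_nbhd_def real_vec_nth mem_Collect_eq
      by (metis abs_minus_commute of_int_abs of_int_diff of_int_less_1_iff zabs_less_one_iff eq_iff_diff_eq_0)
    then show ?thesis by (simp add: vec_eq_iff)
  qed
  then show ?thesis by (auto simp: integral_nbhd_def)
qed

section \<open>Lower bounds for the local convex extension\<close>

lemma local_convex_extension_real_vec: "local_convex_extension f (real_vec z) \<le> f z"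
proof -
  have "(\<lambda>_. 1) \<in> convex_weights (real_vec z)"
    by (simp add: convex_weights_def integral_nbhd_real_vec)
  then show ?thesis
    unfolding local_convex_extension_def
    by (rule INF_lower2) (simp add: integral_nbhd_real_vec one_ereal_def[symmetric])
qed

text \<open>The real-valued minorant \<open>g\<close> moves the estimate of weighted sums from
  \<open>ereal\<close> to real arithmetic.\<close>

lemma local_convex_extension_greatest:
  assumes "\<And>z. z \<in> integral_nbhd x \<Longrightarrow> ereal (g z) \<le> f z"
    and "\<And>w. w \<in> convex_weights x \<Longrightarrow> s \<le> (\<Sum>z\<in>integral_nbhd x. w z * g z)"
  shows "ereal s \<le> local_convex_extension f x"
  unfolding local_convex_extension_def
proof (rule INF_greatest)
  fix w assume w: "w \<in> convex_weights x"
  have "ereal s \<le> ereal (\<Sum>z\<in>integral_nbhd x. w z * g z)"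
    using assms(2)[OF w] by simp
  also have "\<dots> = (\<Sum>z\<in>integral_nbhd x. ereal (w z) * ereal (g z))"
    by simp
  also have "\<dots> \<le> (\<Sum>z\<in>integral_nbhd x. ereal (w z) * f z)"
    using w assms(1) by (intro sum_mono ereal_mult_left_mono) (auto simp: convex_weights_def)
  finally show "ereal s \<le> (\<Sum>z\<in>integral_nbhd x. ereal (w z) * f z)" .
qed

text \<open>All integral neighbours of \<open>x\<close> lie in the same closed orthant with apex \<open>c\<close>, where \<open>hinge_sum\<close> is linear.\<close>

lemma hinge_sum_convex_weights:
  assumes w: "w \<in> convex_weights x"
  shows "(\<Sum>z\<in>integral_nbhd x. w z * hinge_sum a b c (real_vec z)) = hinge_sum a b c x"
proof -
  let ?N = "integral_nbhd x"
  have one: "(\<Sum>z\<in>?N. w z) = 1" and bary: "(\<Sum>z\<in>?N. w z *\<^sub>R real_vec z) = x"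
    using w by (auto simp: convex_weights_def)
  have coord: "(\<Sum>z\<in>?N. w z * hinge (a i) (b i) (real_of_int (z $ i) - real_of_int (c $ i)))
      = hinge (a i) (b i) (x $ i - real_of_int (c $ i))" for i
  proof -
    define s where "s = (if real_of_int (c $ i) \<le> x $ i then b i else a i)"
    have "hinge (a i) (b i) (real_of_int (z $ i) - real_of_int (c $ i))
        = s * (real_of_int (z $ i) - real_of_int (c $ i))" if "z \<in> ?N" for z
    proof -
      have *: "\<bar>x $ i - real_of_int (z $ i)\<bar> < 1" using that by (simp add: integral_nbhd_def)
      show ?thesis
      proof (cases "real_of_int (c $ i) \<le> x $ i")
        case True
        then have "c $ i \<le> z $ i" using * by linarith
        then show ?thesis using True by (simp add: s_def hinge_def)
      next
        case False
        then have "z $ i \<le> c $ i" using * by linarith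
        then show ?thesis using False by (auto simp: s_def hinge_def)
      qed
    qed
    then have "(\<Sum>z\<in>?N. w z * hinge (a i) (b i) (real_of_int (z $ i) - real_of_int (c $ i)))
        = (\<Sum>z\<in>?N. w z * (s * (real_of_int (z $ i) - real_of_int (c $ i))))"
      by simp
    also have "\<dots> = s * ((\<Sum>z\<in>?N. w z * real_of_int (z $ i)) - (\<Sum>z\<in>?N. w z) * real_of_int (c $ i))"
      by (simp add: sum_distrib_left sum_distrib_right sum_subtractf algebra_simps)
    also have "(\<Sum>z\<in>?N. w z * real_of_int (z $ i)) = x $ i"
      using arg_cong[OF bary, of "\<lambda>v. v $ i"] by simp
    finally show ?thesis using one by (simp add: s_def hinge_def)
  qed
  have "(\<Sum>z\<in>?N. w z * hinge_sum a b c (real_vec z))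
      = (\<Sum>i\<in>UNIV. \<Sum>z\<in>?N. w z * hinge (a i) (b i) (real_of_int (z $ i) - real_of_int (c $ i)))"
    unfolding hinge_sum_def sum_distrib_left real_vec_nth by (rule sum.swap)
  also have "\<dots> = hinge_sum a b c x" by (simp add: coord hinge_sum_def)
  finally show ?thesis .
qed

text \<open>Averaging the minorant over the neighbours of \<open>x\<close> reproduces its value at
  \<open>x\<close>, by linearity on their common orthant.\<close>

lemma hinge_minorant_local_convex_extension:
  assumes "hinge_minorant f c r a b" and "\<And>i. \<bar>x $ i - real_of_int (c $ i)\<bar> \<le> 1"
  shows "ereal (r + hinge_sum a b c x) \<le> local_convex_extension f x"
proof (rule local_convex_extension_greatest)
  show "ereal (r + hinge_sum a b c (real_vec z)) \<le> f z" if "z \<in> integral_nbhd x" for z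
    using assms that integral_nbhd_subset_unit_cube[of x c] by (auto simp: hinge_minorant_def)
  show "r + hinge_sum a b c x \<le> (\<Sum>z\<in>integral_nbhd x. w z * (r + hinge_sum a b c (real_vec z)))"
    if w: "w \<in> convex_weights x" for w
    using w by (simp add: distrib_left sum.distrib hinge_sum_convex_weights sum_distrib_right[symmetric])
      (simp add: convex_weights_def)
qed

text \<open>Convexity of the local convex extension enters here. Only \<open>m\<close> has to be
  near \<open>c\<close>; the end points may be far away, as the global subgradient inequality
  requires.\<close>

lemma hinge_minorant_segment:
  assumes "integrally_convex f" "hinge_minorant f c r a b"
    and "0 \<le> t" "t \<le> 1" and "f x = ereal u" "f y = ereal v"
    and m: "m = (1 - t) *\<^sub>R real_vec x + t *\<^sub>R real_vec y"
    and "\<And>i. \<bar>m $ i - real_of_int (c $ i)\<bar> \<le> 1"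
  shows "r + hinge_sum a b c m \<le> (1 - t) * u + t * v"
proof -
  have "ereal (r + hinge_sum a b c m) \<le> local_convex_extension f m"
    using assms by (intro hinge_minorant_local_convex_extension)
  also have "\<dots> \<le> ereal (1 - t) * local_convex_extension f (real_vec x)
      + ereal t * local_convex_extension f (real_vec y)"
    using assms(1,3,4) unfolding m integrally_convex_def ereal_convex_def by blast
  also have "\<dots> \<le> ereal (1 - t) * f x + ereal t * f y"
    using assms(3,4) by (intro add_mono ereal_mult_left_mono local_convex_extension_real_vec) auto
  finally show ?thesis using assms(5,6) by simp
qed

section \<open>Concavity, splitting and integrality of hinge sums\<close>

lemma hinge_concave_midpoint:
  assumes "b \<le> a"
  shows "hinge a b s + hinge a b t \<le> 2 * hinge a b ((s + t) / 2)"
proof -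
  have min: "hinge a b u = min (a * u) (b * u)" for u
    using mult_right_mono[of b a u] mult_right_mono_neg[of b a u] assms
    by (auto simp: hinge_def min_def)
  show ?thesis unfolding min by (auto simp: min_def field_simps)
qed

lemma hinge_sum_concave_midpoint:
  assumes "\<And>i. b i \<le> a i"
  shows "hinge_sum a b c x + hinge_sum a b c y \<le> 2 * hinge_sum a b c ((1 - 1/2) *\<^sub>R x + (1/2) *\<^sub>R y)"
proof -
  have "hinge (a i) (b i) (x $ i - real_of_int (c $ i)) + hinge (a i) (b i) (y $ i - real_of_int (c $ i))
      \<le> 2 * hinge (a i) (b i) (((1 - 1/2) *\<^sub>R x + (1/2) *\<^sub>R y) $ i - real_of_int (c $ i))" for i
    using hinge_concave_midpoint[OF assms, of i "x $ i - real_of_int (c $ i)" "y $ i - real_of_int (c $ i)"]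
    by (simp add: field_simps)
  then show ?thesis
    unfolding hinge_sum_def sum_distrib_left sum.distrib[symmetric] by (intro sum_mono)
qed

text \<open>Zero slopes at \<open>k\<close> delete that coordinate while the index type stays the
  same.\<close>

lemma hinge_sum_remove:
  "hinge_sum a b c x
     = hinge (a k) (b k) (x $ k - real_of_int (c $ k)) + hinge_sum (a(k := 0)) (b(k := 0)) c x"
proof -
  have "hinge_sum (a(k := 0)) (b(k := 0)) c x
      = (\<Sum>i\<in>UNIV - {k}. hinge (a i) (b i) (x $ i - real_of_int (c $ i)))"
    unfolding hinge_sum_def by (subst sum.remove[of _ k]) (auto simp: hinge_def intro: sum.cong)
  then show ?thesis
    unfolding hinge_sum_def by (subst sum.remove[of _ k]) auto
qed

text \<open>The additive group \<open>R\<close> will be \<open>\<real>\<close> or \<open>\<int>\<close>.\<close>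

lemma hinge_sum_mem:
  assumes "\<And>i. a i \<in> R" "\<And>i. b i \<in> R" "0 \<in> R" "\<And>x y. x \<in> R \<Longrightarrow> y \<in> R \<Longrightarrow> x - y \<in> R"
    and z: "z \<in> unit_cube c"
  shows "hinge_sum a b c (real_vec z) \<in> R"
proof -
  have add: "x + y \<in> R" if "x \<in> R" "y \<in> R" for x y
    using assms(4)[OF that(1) assms(4)[OF assms(3) that(2)]] by simp
  have "hinge (a i) (b i) (real_of_int (z $ i) - real_of_int (c $ i)) \<in> R" for i
  proof -
    \<comment> \<open>On the cube each hinge is \<open>- a i\<close>, \<open>0\<close> or
      \<open>b i\<close>, so closure of \<open>R\<close> under subtraction suffices.\<close>
    have "z $ i - c $ i = -1 \<or> z $ i - c $ i = 0 \<or> z $ i - c $ i = 1"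
      using z unfolding unit_cube_def mem_Collect_eq by (smt (verit))
    then have "real_of_int (z $ i) - real_of_int (c $ i) \<in> {-1, 0, 1}"
      by (auto simp flip: of_int_diff)
    then show ?thesis
      using assms(1-3) assms(4)[OF assms(3) assms(1)] by (auto simp: hinge_def)
  qed
  then have "(\<Sum>i\<in>I. hinge (a i) (b i) (real_of_int (z $ i) - real_of_int (c $ i))) \<in> R" for I
    by (induction I rule: infinite_finite_induct) (auto simp: assms(3) add)
  then show ?thesis by (simp add: hinge_sum_def)
qed

section \<open>Elimination of the hinges\<close>

text \<open>The merged slope is the largest lower bound. It is attained in a finite set of elements
  of \<open>R\<close>, which settles the real and the integral case together.\<close>

lemma hinge_minorant_linearize_coordinate:
  fixes f :: "int ^ 'n \<Rightarrow> ereal"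
  assumes ic: "integrally_convex f" and minor: "hinge_minorant f c r a b"
    and ba: "\<And>i. b i \<le> a i"
    and R: "0 \<in> R" "\<And>x y. x \<in> R \<Longrightarrow> y \<in> R \<Longrightarrow> x - y \<in> R"
    and fR: "\<And>z u. f z = ereal u \<Longrightarrow> u \<in> R" and rR: "r \<in> R"
    and abR: "\<And>i. a i \<in> R" "\<And>i. b i \<in> R"
  shows "\<exists>p\<in>R. b k \<le> p \<and> p \<le> a k \<and> hinge_minorant f c r (a(k := p)) (b(k := p))"
proof -
  define h where "h z = hinge_sum (a(k := 0)) (b(k := 0)) c (real_vec z)" for z
  define Y where "Y = {z \<in> unit_cube c. z $ k = c $ k - 1 \<and> f z \<noteq> \<infinity>}"
  \<comment> \<open>A point \<open>z\<close> of \<open>Y\<close> requires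
    \<open>r - p + h z \<le> f z\<close>, a lower bound on \<open>p\<close>. Inserting
    \<open>b k\<close> makes \<open>L\<close> nonempty and forces
    \<open>b k \<le> p\<close>.\<close>
  define L where "L = insert (b k) ((\<lambda>z. r + h z - real_of_ereal (f z)) ` Y)"
  define p where "p = Max L"
  have fin: "\<exists>u. f z = ereal u" if "f z \<noteq> \<infinity>" for z
    using ic that unfolding integrally_convex_def by (metis ereal_cases)
  have add: "x + y \<in> R" if "x \<in> R" "y \<in> R" for x y
    using R(2)[OF that(1) R(2)[OF R(1) that(2)]] by simp
  have "finite L"
    using finite_unit_cube[of c] by (simp add: L_def Y_def)
  moreover have "L \<noteq> {}" by (simp add: L_def)
  ultimately have pL: "p \<in> L" and p_ge: "\<And>l. l \<in> L \<Longrightarrow> l \<le> p"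
    unfolding p_def by (auto intro: Max_in Max_ge)
  have hR: "h z \<in> R" if "z \<in> unit_cube c" for z
    unfolding h_def using that R abR by (intro hinge_sum_mem) auto
  have "l \<in> R" if "l \<in> L" for l
    using that fin abR hR by (fastforce simp: L_def Y_def intro: R add rR dest: fR)
  then have pR: "p \<in> R" using pL .
  have h_le: "r + h z + hinge (a k) (b k) (real_of_int (z $ k) - real_of_int (c $ k)) \<le> u"
    if "z \<in> unit_cube c" "f z = ereal u" for z u
    using minor that hinge_sum_remove[of a b c "real_vec z" k]
    by (auto simp: hinge_minorant_def h_def dest!: bspec)
  \<comment> \<open>Compatibility: each lower bound in \<open>L\<close> lies below each upper bound,
    coming from the layer above \<open>c\<close>.\<close>
  have up: "l \<le> u - r - h x"
    if x: "x \<in> unit_cube c" "x $ k = c $ k + 1" "f x = ereal u" and l: "l \<in> L" for x u l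
  proof (cases "l = b k")
    case True
    then show ?thesis using h_le[OF x(1,3)] x(2) by (simp add: hinge_def)
  next
    case False
    then obtain y where y: "y \<in> unit_cube c" "y $ k = c $ k - 1" "f y \<noteq> \<infinity>"
      and ly: "l = r + h y - real_of_ereal (f y)"
      using l by (auto simp: L_def Y_def)
    obtain v where v: "f y = ereal v" using fin y(3) by blast
    define m where "m = (1 - 1/2) *\<^sub>R real_vec x + (1/2) *\<^sub>R real_vec y"
    have "r + hinge_sum a b c m \<le> (1 - 1/2) * u + 1/2 * v"
    proof (rule hinge_minorant_segment[OF ic minor _ _ x(3) v m_def])
      fix i
      have "\<bar>x $ i - c $ i\<bar> \<le> 1" "\<bar>y $ i - c $ i\<bar> \<le> 1"
        using x(1) y(1) by (auto simp: unit_cube_def)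
      then have "\<bar>real_of_int (x $ i) - real_of_int (c $ i)\<bar> \<le> 1"
        "\<bar>real_of_int (y $ i) - real_of_int (c $ i)\<bar> \<le> 1"
        by linarith+
      then show "\<bar>m $ i - real_of_int (c $ i)\<bar> \<le> 1"
        by (simp add: m_def abs_le_iff)
    qed auto
    \<comment> \<open>The midpoint lies in the layer of \<open>c\<close>, so the hinge in coordinate
      \<open>k\<close> vanishes there.\<close>
    moreover have "m $ k = real_of_int (c $ k)"
      using x(2) y(2) by (simp add: m_def field_simps)
    then have "hinge_sum a b c m = hinge_sum (a(k := 0)) (b(k := 0)) c m"
      by (subst hinge_sum_remove[of _ _ _ _ k]) (simp add: hinge_def)
    \<comment> \<open>Concavity bounds the value at the midpoint below by the average of
      \<open>h x\<close> and \<open>h y\<close>. Together this gives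
      \<open>2 * r + h x + h y \<le> u + v\<close>, the required comparison.\<close>
    moreover have "h x + h y \<le> 2 * hinge_sum (a(k := 0)) (b(k := 0)) c m"
      unfolding h_def m_def using ba by (intro hinge_sum_concave_midpoint) auto
    ultimately show ?thesis using v ly by simp
  qed
  \<comment> \<open>The given minorant at a point of \<open>Y\<close> has the hinge value
    \<open>- a k\<close>, so it bounds the corresponding element of \<open>L\<close> by
    \<open>a k\<close>.\<close>
  have p_le: "p \<le> a k"
  proof -
    have "l \<le> a k" if l: "l \<in> L" for l
    proof (cases "l = b k")
      case False
      then obtain y where y: "y \<in> unit_cube c" "y $ k = c $ k - 1" "f y \<noteq> \<infinity>"
        and ly: "l = r + h y - real_of_ereal (f y)"
        using l by (auto simp: L_def Y_def)
      obtain v where v: "f y = ereal v" using fin y(3) by blast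
      show ?thesis using h_le[OF y(1) v] y(2) ly v by (simp add: hinge_def)
    qed (simp add: ba)
    then show ?thesis using pL .
  qed
  have "hinge_minorant f c r (a(k := p)) (b(k := p))"
    unfolding hinge_minorant_def
  proof
    fix z assume z: "z \<in> unit_cube c"
    show "ereal (r + hinge_sum (a(k := p)) (b(k := p)) c (real_vec z)) \<le> f z"
    proof (cases "f z = \<infinity>")
      case False
      then obtain u where u: "f z = ereal u" using fin by blast
      have sum: "hinge_sum (a(k := p)) (b(k := p)) c (real_vec z)
          = p * (real_of_int (z $ k) - real_of_int (c $ k)) + h z"
        by (subst hinge_sum_remove[of _ _ _ _ k]) (simp add: hinge_def h_def)
      have "z $ k = c $ k - 1 \<or> z $ k = c $ k \<or> z $ k = c $ k + 1"
        using z unfolding unit_cube_def mem_Collect_eq by (smt (verit))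
      then consider "z $ k = c $ k - 1" | "z $ k = c $ k" | "z $ k = c $ k + 1" by blast
      then have "r + (p * (real_of_int (z $ k) - real_of_int (c $ k)) + h z) \<le> u"
      proof cases
        case 1
        then have "r + h z - u \<le> p"
          using z u False by (intro p_ge) (force simp: L_def Y_def)
        then show ?thesis using 1 by simp
      next
        case 2
        then show ?thesis using h_le[OF z u] by (simp add: hinge_def)
      next
        case 3
        then show ?thesis using up[OF z 3 u pL] by simp
      qed
      then show ?thesis using u sum by simp
    qed simp
  qed
  moreover have "b k \<le> p" by (rule p_ge) (simp add: L_def)
  ultimately show ?thesis using pR p_le by blast
qed

text \<open>Induction over the set \<open>K\<close> of merged coordinates. The intervals from
  \<open>b' i\<close> to \<open>a' i\<close> only shrink, and merged ones stay fixed.\<close>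

lemma hinge_minorant_linearize:
  fixes f :: "int ^ 'n \<Rightarrow> ereal"
  assumes ic: "integrally_convex f" and minor: "hinge_minorant f c r a b"
    and ba: "\<And>i. b i \<le> a i"
    and R: "0 \<in> R" "\<And>x y. x \<in> R \<Longrightarrow> y \<in> R \<Longrightarrow> x - y \<in> R"
    and fR: "\<And>z u. f z = ereal u \<Longrightarrow> u \<in> R" and rR: "r \<in> R"
    and abR: "\<And>i. a i \<in> R" "\<And>i. b i \<in> R"
  shows "\<exists>p. (\<forall>i. p i \<in> R \<and> b i \<le> p i \<and> p i \<le> a i) \<and> hinge_minorant f c r p p"
proof -
  have "\<exists>a' b'. (\<forall>i. a' i \<in> R \<and> b' i \<in> R \<and> b i \<le> b' i \<and> b' i \<le> a' i \<and> a' i \<le> a i)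
      \<and> (\<forall>i\<in>K. a' i = b' i) \<and> hinge_minorant f c r a' b'" if "finite K" for K
    using that
  proof (induction K)
    case empty
    show ?case using minor ba abR by - (rule exI[of _ a], rule exI[of _ b], auto)
  next
    case (insert k K)
    then obtain a' b' where
      ab: "\<forall>i. a' i \<in> R \<and> b' i \<in> R \<and> b i \<le> b' i \<and> b' i \<le> a' i \<and> a' i \<le> a i"
      and eq: "\<forall>i\<in>K. a' i = b' i" and minor': "hinge_minorant f c r a' b'"
      by blast
    have "\<exists>p\<in>R. b' k \<le> p \<and> p \<le> a' k \<and> hinge_minorant f c r (a'(k := p)) (b'(k := p))"
      using ab by (intro hinge_minorant_linearize_coordinate ic minor' R rR) (auto dest: fR)
    then obtain p where p: "p \<in> R" "b' k \<le> p" "p \<le> a' k"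
      "hinge_minorant f c r (a'(k := p)) (b'(k := p))"
      by blast
    have "b k \<le> p" "p \<le> a k" using p ab by (meson order_trans)+
    then show ?case
      using p ab eq by - (rule exI[of _ "a'(k := p)"], rule exI[of _ "b'(k := p)"], auto simp: fun_upd_def)
  qed
  from this[of UNIV] obtain a' b' where
    ab: "\<forall>i. a' i \<in> R \<and> b' i \<in> R \<and> b i \<le> b' i \<and> b' i \<le> a' i \<and> a' i \<le> a i"
    and eq: "\<forall>i. a' i = b' i" and minor': "hinge_minorant f c r a' b'"
    by auto
  have "a' = b'" using eq by auto
  then show ?thesis using ab minor' by blast
qed

section \<open>From a local to a global subgradient\<close>

text \<open>A point of the segment from \<open>c\<close> to \<open>x\<close> close to
  \<open>c\<close> lies in the box, where the minorant is known; convexity carries the inequality on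
  to \<open>x\<close>.\<close>

lemma linear_minorant_global:
  fixes f :: "int ^ 'n \<Rightarrow> ereal"
  assumes ic: "integrally_convex f" and fc: "f c = ereal r"
    and minor: "hinge_minorant f c r (\<lambda>i. p $ i) (\<lambda>i. p $ i)"
  shows "ereal (r + p \<bullet> (real_vec x - real_vec c)) \<le> f x"
proof (cases "f x = \<infinity>")
  case False
  then obtain u where u: "f x = ereal u"
    using ic unfolding integrally_convex_def by (metis ereal_cases)
  define d where "d = real_vec x - real_vec c"
  \<comment> \<open>This brings every coordinate of \<open>t *\<^sub>R d\<close> below 1 in absolute
    value; the summand 1 covers \<open>d = 0\<close>.\<close>
  define t where "t = 1 / (1 + norm d)"
  have pos: "0 < 1 + norm d" using norm_ge_zero[of d] by linarith
  then have t: "0 < t" "t \<le> 1" by (auto simp: t_def)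
  define m where "m = (1 - t) *\<^sub>R real_vec c + t *\<^sub>R real_vec x"
  have m: "m $ i - real_of_int (c $ i) = t * d $ i" for i
    by (simp add: m_def d_def algebra_simps)
  have "r + hinge_sum (\<lambda>i. p $ i) (\<lambda>i. p $ i) c m \<le> (1 - t) * r + t * u"
  proof (rule hinge_minorant_segment[OF ic minor _ _ fc u m_def])
    fix i
    have "\<bar>d $ i\<bar> \<le> norm d" by (rule component_le_norm_cart)
    then show "\<bar>m $ i - real_of_int (c $ i)\<bar> \<le> 1"
      unfolding m using pos by (simp add: t_def abs_mult field_simps)
  qed (use t in auto)
  moreover have "hinge_sum (\<lambda>i. p $ i) (\<lambda>i. p $ i) c m = t * (p \<bullet> d)"
    by (simp add: hinge_sum_def m hinge_def inner_vec_def sum_distrib_left algebra_simps)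
  ultimately have "t * (r + p \<bullet> d) \<le> t * u" by (simp add: algebra_simps)
  then show ?thesis using t u by (simp add: d_def)
qed simp

section \<open>Univariate discrete concave functions\<close>

lemma discrete_concave_reflect:
  assumes "discrete_concave \<psi>"
  shows "discrete_concave (\<lambda>k. \<psi> (- k))"
proof -
  have int: "int_interval (dom_concave \<psi>)"
    and mid: "\<And>k. \<psi> (k - 1) + \<psi> (k + 1) \<le> 2 * \<psi> k" and fin: "\<And>k. \<psi> k \<noteq> \<infinity>"
    using assms by (auto simp: discrete_concave_def)
  have "int_interval (dom_concave (\<lambda>k. \<psi> (- k)))"
    unfolding int_interval_def
  proof (intro ballI subsetI)
    fix a b k assume "a \<in> dom_concave (\<lambda>k. \<psi> (- k))" "b \<in> dom_concave (\<lambda>k. \<psi> (- k))" "k \<in> {a..b}"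
    then have "- b \<in> dom_concave \<psi>" "- a \<in> dom_concave \<psi>" "- k \<in> {- b..- a}"
      by (auto simp: dom_concave_def)
    then have "- k \<in> dom_concave \<psi>" using int unfolding int_interval_def by blast
    then show "k \<in> dom_concave (\<lambda>k. \<psi> (- k))" by (simp add: dom_concave_def)
  qed
  moreover have "\<psi> (- (k - 1)) + \<psi> (- (k + 1)) \<le> 2 * \<psi> (- k)" for k
  proof -
    have "- (k - 1) = - k + 1" "- (k + 1) = - k - 1" by simp_all
    then show ?thesis using mid[of "- k"] by (simp only: add.commute)
  qed
  ultimately show ?thesis using fin by (simp add: discrete_concave_def)
qed

text \<open>Increments do not grow to the right, so a bound on the first one propagates.\<close>

lemma discrete_concave_le_right:
  assumes \<psi>: "discrete_concave \<psi>" and c: "\<psi> c = ereal s" and step: "\<psi> (c + 1) \<le> ereal (s + p)"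
  shows "\<psi> (c + int n) \<le> ereal (s + p * real n)"
proof -
  have int: "int_interval (dom_concave \<psi>)"
    and mid: "\<And>k. \<psi> (k - 1) + \<psi> (k + 1) \<le> 2 * \<psi> k" and fin: "\<And>k. \<psi> k \<noteq> \<infinity>"
    using \<psi> by (auto simp: discrete_concave_def)
  have incr: "\<psi> (c + int n + 1) \<le> \<psi> (c + int n) + ereal p" for n
  proof (induction n)
    case 0
    then show ?case using c step by simp
  next
    case (Suc n)
    show ?case
    proof (cases "\<psi> (c + int n + 2) = - \<infinity>")
      case True
      then show ?thesis by (simp add: algebra_simps)
    next
      case False
      then have "c \<in> dom_concave \<psi>" "c + int n + 2 \<in> dom_concave \<psi>"
        using c by (auto simp: dom_concave_def)
      \<comment> \<open>The interval property makes three consecutive values finite, so the midpoint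
        inequality becomes one between reals.\<close>
      then have "{c..c + int n + 2} \<subseteq> dom_concave \<psi>"
        using int unfolding int_interval_def by blast
      then have "c + int n \<in> dom_concave \<psi>" "c + int n + 1 \<in> dom_concave \<psi>" by auto
      then obtain u v w where uvw: "\<psi> (c + int n) = ereal u" "\<psi> (c + int n + 1) = ereal v"
        "\<psi> (c + int n + 2) = ereal w"
        using fin False unfolding dom_concave_def mem_Collect_eq
        by (metis ereal_cases less_irrefl)
      have "u + w \<le> 2 * v"
        using mid[of "c + int n + 1"] uvw
        by (simp add: add.assoc ereal_mult_eq_MInfty numeral_eq_ereal)
      moreover have "v \<le> u + p" using Suc.IH uvw by simp
      ultimately have "\<psi> (c + int n + 2) \<le> \<psi> (c + int n + 1) + ereal p" using uvw by simp
      moreover have "c + int (Suc n) = c + int n + 1" "c + int (Suc n) + 1 = c + int n + 2" by auto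
      ultimately show ?thesis by (simp only:)
    qed
  qed
  show ?thesis
  proof (induction n)
    case 0
    then show ?case using c by simp
  next
    case (Suc n)
    have "\<psi> (c + int (Suc n)) \<le> \<psi> (c + int n) + ereal p"
      using incr[of n] by (simp add: algebra_simps)
    also have "\<dots> \<le> ereal (s + p * real n) + ereal p"
      using Suc.IH by (rule add_right_mono)
    finally show ?case by (simp add: algebra_simps)
  qed
qed

text \<open>The two unit steps decide everything; the left side is the right side of the reflected
  function with slope \<open>- p\<close>.\<close>

lemma discrete_concave_supergradient:
  assumes \<psi>: "discrete_concave \<psi>" and c: "\<psi> c = ereal s"
    and right: "\<psi> (c + 1) \<le> ereal (s + p)" and left: "\<psi> (c - 1) \<le> ereal (s - p)"
  shows "\<psi> k \<le> ereal (s + p * (real_of_int k - real_of_int c))"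
proof (cases "c \<le> k")
  case True
  then show ?thesis
    using discrete_concave_le_right[OF \<psi> c right, of "nat (k - c)"] by simp
next
  case False
  then show ?thesis
    using discrete_concave_le_right[OF discrete_concave_reflect[OF \<psi>], of "- c" s "- p" "nat (c - k)"]
      c left by (simp add: algebra_simps)
qed

section \<open>Common subgradients at a minimiser\<close>

lemma common_subgradient:
  fixes f \<Psi> :: "int ^ 'n \<Rightarrow> ereal"
  assumes ic: "integrally_convex f" and sep: "separable_concave \<Psi>"
    and fc: "f c = ereal r" and \<Psi>c: "\<Psi> c = ereal s"
    and opt: "\<And>x. ereal (r - s) \<le> f x - \<Psi> x"
    and R: "1 \<in> R" "\<And>x y. x \<in> R \<Longrightarrow> y \<in> R \<Longrightarrow> x - y \<in> R"
    and fR: "\<And>z u. f z = ereal u \<Longrightarrow> u \<in> R" and \<Psi>R: "\<And>z u. \<Psi> z = ereal u \<Longrightarrow> u \<in> R"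
  shows "\<exists>p :: real ^ 'n. (\<forall>i. p $ i \<in> R)
     \<and> (\<forall>x. ereal (r + p \<bullet> (real_vec x - real_vec c)) \<le> f x)
     \<and> (\<forall>x. \<Psi> x \<le> ereal (s + p \<bullet> (real_vec x - real_vec c)))"
proof -
  obtain \<psi> where \<psi>: "\<And>i. discrete_concave (\<psi> i)" and \<Psi>: "\<And>x. \<Psi> x = (\<Sum>i\<in>UNIV. \<psi> i (x $ i))"
    using sep unfolding separable_concave_def by blast
  have \<psi>_fin: "\<psi> i k \<noteq> \<infinity>" for i k
    using \<psi>[of i] by (simp add: discrete_concave_def)
  have R0: "0 \<in> R" using R(2)[OF R(1) R(1)] by simp
  have f_fin: "\<exists>u. f z = ereal u" if "f z \<noteq> \<infinity>" for z
    using ic that unfolding integrally_convex_def by (metis ereal_cases)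
  define \<sigma> where "\<sigma> i = real_of_ereal (\<psi> i (c $ i))" for i
  have \<sigma>: "\<psi> i (c $ i) = ereal (\<sigma> i)" for i
  proof -
    have "\<bar>\<Sum>i\<in>UNIV. \<psi> i (c $ i)\<bar> \<noteq> \<infinity>" using \<Psi>c \<Psi>[of c] by simp
    then have "\<bar>\<psi> i (c $ i)\<bar> \<noteq> \<infinity>" unfolding sum_Inf by auto
    then show ?thesis by (simp add: \<sigma>_def ereal_real')
  qed
  have s: "s = (\<Sum>i\<in>UNIV. \<sigma> i)"
    using \<Psi>c \<Psi>[of c] \<sigma> by simp
  \<comment> \<open>The summands of \<open>\<Psi>\<close> need not take values in \<open>R\<close>,
    but their differences do: changing one coordinate of \<open>c\<close> changes
    \<open>\<Psi>\<close> by exactly \<open>u - \<sigma> i\<close>.\<close>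
  have diffR: "u - \<sigma> i \<in> R" if u: "\<psi> i v = ereal u" for i v u
  proof -
    define z where "z = (\<chi> j. if j = i then v else c $ j)"
    have "\<psi> j (z $ j) = ereal ((if j = i then u - \<sigma> i else 0) + \<sigma> j)" for j
      using u \<sigma> by (simp add: z_def)
    then have "\<Psi> z = ereal ((u - \<sigma> i) + s)"
      by (simp add: \<Psi> s sum.distrib)
    then have "u - \<sigma> i + s \<in> R" by (rule \<Psi>R)
    from R(2)[OF this \<Psi>R[OF \<Psi>c]] show ?thesis by simp
  qed
  \<comment> \<open>Right and left slopes at \<open>c\<close>. At an infinite value
    \<open>real_of_ereal\<close> yields 0; the resulting number is no slope, but \<open>S\<close>
    still covers it.\<close>
  define \<beta> where "\<beta> i = real_of_ereal (\<psi> i (c $ i + 1)) - \<sigma> i" for i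
  define \<alpha> where "\<alpha> i = \<sigma> i - real_of_ereal (\<psi> i (c $ i - 1))" for i
  have \<beta>: "\<psi> i (c $ i + 1) = ereal (\<sigma> i + \<beta> i)" if "\<psi> i (c $ i + 1) \<noteq> - \<infinity>" for i
    using that \<psi>_fin[of i "c $ i + 1"] by (cases "\<psi> i (c $ i + 1)") (auto simp: \<beta>_def)
  have \<alpha>: "\<psi> i (c $ i - 1) = ereal (\<sigma> i - \<alpha> i)" if "\<psi> i (c $ i - 1) \<noteq> - \<infinity>" for i
    using that \<psi>_fin[of i "c $ i - 1"] by (cases "\<psi> i (c $ i - 1)") (auto simp: \<alpha>_def)
  define S where "S = (\<Sum>i\<in>UNIV. \<bar>\<alpha> i\<bar> + \<bar>\<beta> i\<bar>)"
  have S: "\<bar>\<alpha> i\<bar> + \<bar>\<beta> i\<bar> \<le> S" for i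
    unfolding S_def by (rule member_le_sum) auto
  have S0: "0 \<le> S" unfolding S_def by (intro sum_nonneg) auto
  \<comment> \<open>\<open>B\<close> is chosen so that a single hinge value \<open>- M\<close> with
    \<open>B \<le> M\<close> outweighs all the others, whose sum is at most
    \<open>S\<close>.\<close>
  have "bdd_above ((\<lambda>z. r + S - real_of_ereal (f z)) ` unit_cube c)"
    using finite_unit_cube by (intro bdd_above_finite finite_imageI)
  then obtain B where B: "\<And>z. z \<in> unit_cube c \<Longrightarrow> r + S - real_of_ereal (f z) \<le> B"
    by (auto simp: bdd_above_def)
  \<comment> \<open>Infinite slopes are replaced by \<open>\<plusminus>M\<close>, large enough not to lose the minorant on the finite cube.\<close>
  obtain N :: nat where N: "max B S \<le> real N" using real_arch_simple by blast
  define M where "M = real N"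
  have MB: "B \<le> M" and MS: "S \<le> M" using N by (auto simp: M_def)
  have MR: "M \<in> R"
  proof -
    have "real n \<in> R" for n
    proof (induction n)
      case (Suc n)
      have "real n - (0 - 1) \<in> R" by (intro R(2) Suc R0 R(1))
      then show ?case by (simp add: add.commute)
    qed (simp add: R0)
    then show ?thesis by (simp add: M_def)
  qed
  define b where "b i = (if \<psi> i (c $ i + 1) = - \<infinity> then - M else \<beta> i)" for i
  define a where "a i = (if \<psi> i (c $ i - 1) = - \<infinity> then M else \<alpha> i)" for i
  have aR: "a i \<in> R" for i
    using R(2)[OF R0 diffR[OF \<alpha>[of i]]] MR by (auto simp: a_def)
  have bR: "b i \<in> R" for i
    using diffR[OF \<beta>[of i]] R(2)[OF R0 MR] by (auto simp: b_def)
  have ba: "b i \<le> a i" for i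
  proof (cases "\<psi> i (c $ i + 1) = - \<infinity> \<or> \<psi> i (c $ i - 1) = - \<infinity>")
    case True
    then show ?thesis using S[of i] S0 MS by (auto simp: a_def b_def)
  next
    case False
    have "\<psi> i (c $ i - 1) + \<psi> i (c $ i + 1) \<le> 2 * \<psi> i (c $ i)"
      using \<psi>[of i] by (simp add: discrete_concave_def)
    then show ?thesis
      using False \<alpha>[of i] \<beta>[of i] \<sigma>[of i] by (simp add: a_def b_def numeral_eq_ereal)
  qed
  have minor: "hinge_minorant f c r a b"
    unfolding hinge_minorant_def
  proof
    fix z assume z: "z \<in> unit_cube c"
    let ?h = "\<lambda>i. hinge (a i) (b i) (real_of_int (z $ i) - real_of_int (c $ i))"
    have cases: "z $ i = c $ i - 1 \<or> z $ i = c $ i \<or> z $ i = c $ i + 1" for i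
      using z unfolding unit_cube_def mem_Collect_eq by (smt (verit))
    show "ereal (r + hinge_sum a b c (real_vec z)) \<le> f z"
    proof (cases "f z = \<infinity>")
      case False
      then obtain u where u: "f z = ereal u" using f_fin by blast
      have "r + (\<Sum>i\<in>UNIV. ?h i) \<le> u"
      proof (cases "\<exists>j. \<psi> j (z $ j) = - \<infinity>")
        case True
        then obtain j where j: "\<psi> j (z $ j) = - \<infinity>" by blast
        \<comment> \<open>Outside the effective domain of \<open>\<Psi>\<close> optimality gives no
          information, and the penalty \<open>- M\<close> has to do the work.\<close>
        have hj: "?h j = - M"
          using cases[of j] j \<sigma>[of j] by (auto simp: hinge_def a_def b_def)
        have hi: "?h i \<le> \<bar>\<alpha> i\<bar> + \<bar>\<beta> i\<bar>" for i
          using cases[of i] S0 MS by (auto simp: hinge_def a_def b_def)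
        have "(\<Sum>i\<in>UNIV. ?h i) = - M + (\<Sum>i\<in>UNIV - {j}. ?h i)"
          by (subst sum.remove[of _ j]) (auto simp: hj)
        also have "(\<Sum>i\<in>UNIV - {j}. ?h i) \<le> (\<Sum>i\<in>UNIV - {j}. \<bar>\<alpha> i\<bar> + \<bar>\<beta> i\<bar>)"
          by (rule sum_mono) (rule hi)
        also have "\<dots> \<le> S" unfolding S_def by (rule sum_mono2) auto
        finally show ?thesis using B[OF z] u MB by simp
      next
        case False
        then have fin: "\<psi> i (z $ i) \<noteq> - \<infinity>" for i by blast
        \<comment> \<open>On the cube the hinges reproduce finite values of \<open>\<psi>\<close>
          exactly, so the minorant is the optimality of \<open>c\<close>.\<close>
        have "\<psi> i (z $ i) = ereal (\<sigma> i + ?h i)" for i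
          using cases[of i] fin[of i] \<alpha>[of i] \<beta>[of i] \<sigma>[of i]
          by (auto simp: hinge_def a_def b_def)
        then have "\<Psi> z = ereal (s + (\<Sum>i\<in>UNIV. ?h i))"
          by (simp add: \<Psi> s sum.distrib)
        then show ?thesis using opt[of z] u by simp
      qed
      then show ?thesis using u by (simp add: hinge_sum_def)
    qed simp
  qed
  have "\<exists>q. (\<forall>i. q i \<in> R \<and> b i \<le> q i \<and> q i \<le> a i) \<and> hinge_minorant f c r q q"
    by (intro hinge_minorant_linearize ic minor ba R0 R(2) fR[OF fc] aR bR) (auto dest: fR)
  then obtain q where q: "\<And>i. q i \<in> R" "\<And>i. b i \<le> q i" "\<And>i. q i \<le> a i" "hinge_minorant f c r q q"
    by blast
  define p :: "real ^ 'n" where "p = (\<chi> i. q i)"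
  have "ereal (r + p \<bullet> (real_vec x - real_vec c)) \<le> f x" for x
    using q(4) by (intro linear_minorant_global[OF ic fc]) (simp add: p_def)
  moreover have "\<Psi> x \<le> ereal (s + p \<bullet> (real_vec x - real_vec c))" for x
  proof -
    have "\<psi> i (x $ i) \<le> ereal (\<sigma> i + q i * (real_of_int (x $ i) - real_of_int (c $ i)))" for i
    proof (rule discrete_concave_supergradient[OF \<psi> \<sigma>])
      \<comment> \<open>A replaced slope does no harm: there the left side is minus
        infinity.\<close>
      show "\<psi> i (c $ i + 1) \<le> ereal (\<sigma> i + q i)"
        using q(2)[of i] \<beta>[of i] by (cases "\<psi> i (c $ i + 1) = - \<infinity>") (auto simp: b_def)
      show "\<psi> i (c $ i - 1) \<le> ereal (\<sigma> i - q i)"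
        using q(3)[of i] \<alpha>[of i] by (cases "\<psi> i (c $ i - 1) = - \<infinity>") (auto simp: a_def)
    qed
    then have "\<Psi> x \<le> (\<Sum>i\<in>UNIV. ereal (\<sigma> i + q i * (real_of_int (x $ i) - real_of_int (c $ i))))"
      unfolding \<Psi> by (intro sum_mono)
    also have "\<dots> = ereal (s + p \<bullet> (real_vec x - real_vec c))"
      by (simp add: s sum.distrib inner_vec_def p_def)
    finally show ?thesis .
  qed
  ultimately show ?thesis using q(1) by (intro exI[of _ p]) (auto simp: p_def)
qed

section \<open>Conjugates and duality\<close>

text \<open>Weak duality: test both conjugates at \<open>c\<close>, and the inner products
  cancel.\<close>

lemma conjugate_gap_le:
  assumes fc: "f c = ereal r" and \<Psi>c: "\<Psi> c = ereal s"
  shows "concave_conjugate \<Psi> p - convex_conjugate f p \<le> ereal (r - s)"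
proof -
  have "concave_conjugate \<Psi> p \<le> ereal (p \<bullet> real_vec c - s)"
    unfolding concave_conjugate_def using \<Psi>c by (intro INF_lower2[of c]) auto
  moreover have "ereal (p \<bullet> real_vec c - r) \<le> convex_conjugate f p"
    unfolding convex_conjugate_def using fc by (intro SUP_upper2[of c]) auto
  ultimately have "concave_conjugate \<Psi> p - convex_conjugate f p
      \<le> ereal (p \<bullet> real_vec c - s) - ereal (p \<bullet> real_vec c - r)"
    by (rule ereal_minus_mono)
  then show ?thesis by simp
qed

text \<open>The two inequalities say that no point improves on \<open>c\<close> in either
  conjugate.\<close>

lemma conjugate_gap_ge:
  assumes f: "\<And>x. ereal (r + p \<bullet> (real_vec x - real_vec c)) \<le> f x"
    and \<Psi>: "\<And>x. \<Psi> x \<le> ereal (s + p \<bullet> (real_vec x - real_vec c))"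
  shows "ereal (r - s) \<le> concave_conjugate \<Psi> p - convex_conjugate f p"
proof -
  have "ereal (p \<bullet> real_vec c - s) \<le> concave_conjugate \<Psi> p"
    unfolding concave_conjugate_def
  proof (rule INF_greatest)
    fix x
    show "ereal (p \<bullet> real_vec c - s) \<le> ereal (p \<bullet> real_vec x) - \<Psi> x"
      using \<Psi>[of x] by (cases "\<Psi> x") (auto simp: inner_diff_right)
  qed
  moreover have "convex_conjugate f p \<le> ereal (p \<bullet> real_vec c - r)"
    unfolding convex_conjugate_def
  proof (rule SUP_least)
    fix x
    show "ereal (p \<bullet> real_vec x) - f x \<le> ereal (p \<bullet> real_vec c - r)"
      using f[of x] by (cases "f x") (auto simp: inner_diff_right)
  qed
  ultimately have "ereal (p \<bullet> real_vec c - s) - ereal (p \<bullet> real_vec c - r)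
      \<le> concave_conjugate \<Psi> p - convex_conjugate f p"
    by (rule ereal_minus_mono)
  then show ?thesis by simp
qed

theorem theorem6p1:
  fixes f :: "int ^ 'n \<Rightarrow> ereal" and \<Psi> :: "int ^ 'n \<Rightarrow> ereal"
  assumes "integrally_convex f"
    and "separable_concave \<Psi>"
    and "dom_convex f \<inter> dom_concave \<Psi> \<noteq> {}"
    and "\<exists>x'. f x' - \<Psi> x' = (INF x. f x - \<Psi> x)"
  shows "(INF x. f x - \<Psi> x) = (SUP p. concave_conjugate \<Psi> p - convex_conjugate f p)
      \<and> (\<exists>p'. concave_conjugate \<Psi> p' - convex_conjugate f p'
               = (SUP p. concave_conjugate \<Psi> p - convex_conjugate f p))
      \<and> ((\<forall>x \<in> dom_convex f. \<exists>k::int. f x = ereal (real_of_int k)) \<and>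
         (\<forall>x \<in> dom_concave \<Psi>. \<exists>k::int. \<Psi> x = ereal (real_of_int k)) \<longrightarrow>
           (INF x. f x - \<Psi> x)
             = (SUP q :: int ^ 'n.
                  concave_conjugate \<Psi> (real_vec q) - convex_conjugate f (real_vec q))
         \<and> (\<exists>q' :: int ^ 'n.
              concave_conjugate \<Psi> (real_vec q') - convex_conjugate f (real_vec q')
                = (SUP q :: int ^ 'n.
                     concave_conjugate \<Psi> (real_vec q) - convex_conjugate f (real_vec q))))"
proof -
  let ?gap = "\<lambda>p. concave_conjugate \<Psi> p - convex_conjugate f p"
  obtain c where c: "f c - \<Psi> c = (INF x. f x - \<Psi> x)" using assms(4) by blast
  have f_fin: "f x \<noteq> - \<infinity>" for x using assms(1) by (simp add: integrally_convex_def)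
  have \<Psi>_fin: "\<Psi> x \<noteq> \<infinity>" for x
  proof -
    obtain \<psi> where "\<And>i k. \<psi> i k \<noteq> \<infinity>" "\<Psi> x = (\<Sum>i\<in>UNIV. \<psi> i (x $ i))"
      using assms(2) unfolding separable_concave_def discrete_concave_def by blast
    then show ?thesis by (simp add: sum_Pinfty)
  qed
  obtain x0 where "f x0 < \<infinity>" "\<Psi> x0 > - \<infinity>"
    using assms(3) by (auto simp: dom_convex_def dom_concave_def)
  \<comment> \<open>A common point of the domains makes the minimum less than infinity, which forces
    \<open>f c\<close> and \<open>\<Psi> c\<close> to be finite.\<close>
  then have "f x0 - \<Psi> x0 < \<infinity>"
    by (cases "f x0"; cases "\<Psi> x0") auto
  moreover have le: "f c - \<Psi> c \<le> f x - \<Psi> x" for x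
    unfolding c by (rule INF_lower) simp
  ultimately have "f c - \<Psi> c < \<infinity>" by (rule le_less_trans[rotated])
  then obtain r s where fc: "f c = ereal r" and \<Psi>c: "\<Psi> c = ereal s"
    using f_fin[of c] \<Psi>_fin[of c] by (cases "f c"; cases "\<Psi> c") auto
  have inf: "(INF x. f x - \<Psi> x) = ereal (r - s)" using c fc \<Psi>c by simp
  have opt: "ereal (r - s) \<le> f x - \<Psi> x" for x using le[of x] fc \<Psi>c by simp
  note gap_le = conjugate_gap_le[of f c r \<Psi> s, OF fc \<Psi>c]
  \<comment> \<open>\<open>R\<close> stays open: \<open>UNIV\<close> serves the real statement and
    the integers the integral one.\<close>
  note subgradient = common_subgradient[OF assms(1,2) fc \<Psi>c opt]
  \<comment> \<open>Here \<open>e\<close> will be the identity on real vectors, then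
    \<open>real_vec\<close> on integer ones.\<close>
  have attained: "(SUP q. ?gap (e q)) = ereal (r - s) \<and> ?gap (e q') = (SUP q. ?gap (e q))"
    if "ereal (r - s) \<le> ?gap (e q')" for e :: "'a \<Rightarrow> real ^ 'n" and q'
  proof -
    have "?gap (e q') = ereal (r - s)"
      using that gap_le by (intro antisym)
    moreover from this have "(SUP q. ?gap (e q)) = ereal (r - s)"
      using gap_le by (intro antisym SUP_least SUP_upper2[of q']) auto
    ultimately show ?thesis by simp
  qed
  obtain p where p: "ereal (r - s) \<le> ?gap p"
    using subgradient[of UNIV] conjugate_gap_ge[of r _ c f \<Psi> s] by auto
  have integral: "\<exists>q :: int ^ 'n. ereal (r - s) \<le> ?gap (real_vec q)"
    if int: "\<forall>x \<in> dom_convex f. \<exists>k::int. f x = ereal (real_of_int k)"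
      "\<forall>x \<in> dom_concave \<Psi>. \<exists>k::int. \<Psi> x = ereal (real_of_int k)"
  proof -
    have "u \<in> \<int>" if "f z = ereal u" for z u
    proof -
      have "z \<in> dom_convex f" using that by (simp add: dom_convex_def)
      then show ?thesis using int(1) that by fastforce
    qed
    moreover have "u \<in> \<int>" if "\<Psi> z = ereal u" for z u
    proof -
      have "z \<in> dom_concave \<Psi>" using that by (simp add: dom_concave_def)
      then show ?thesis using int(2) that by fastforce
    qed
    ultimately obtain p where p: "\<forall>i. p $ i \<in> \<int>" and gap: "ereal (r - s) \<le> ?gap p"
      using subgradient[of \<int>] conjugate_gap_ge[of r _ c f \<Psi> s] by auto
    have "real_vec (\<chi> i. \<lfloor>p $ i\<rfloor>) = p"
      using p by (simp add: vec_eq_iff)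
    then show ?thesis using gap by metis
  qed
  show ?thesis
    unfolding inf
  proof (intro conjI impI)
    show "ereal (r - s) = (SUP p. ?gap p)" "\<exists>p'. ?gap p' = (SUP p. ?gap p)"
      using attained[of "\<lambda>p. p", OF p] by auto
  next
    assume "(\<forall>x \<in> dom_convex f. \<exists>k::int. f x = ereal (real_of_int k)) \<and>
      (\<forall>x \<in> dom_concave \<Psi>. \<exists>k::int. \<Psi> x = ereal (real_of_int k))"
    then obtain q :: "int ^ 'n" where "ereal (r - s) \<le> ?gap (real_vec q)"
      using integral by blast
    from attained[of real_vec, OF this]
    show "ereal (r - s) = (SUP q :: int ^ 'n. ?gap (real_vec q))"
      "\<exists>q' :: int ^ 'n. ?gap (real_vec q') = (SUP q :: int ^ 'n. ?gap (real_vec q))"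
      by auto
  qed
qed

end
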